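(* Let $M$ be a topological space. Then $T_c$ is a T-collection on $M$, and hence defines a category, denoted $\nu_c$. One has $T_{\nu_{CL}}=T_c\cup\{\varnothing\}$, hence $\nu_c=\nu_{T_{\nu_{CL}}}$. Moreover $\nu_{CL}\le\nu_{T_{\nu_{CL}}}=\nu_c$, and $$\nu_{CL}\le\nu_c\le\nu_H,$$ i.e. $\nu_{CL}(A)\le\nu_c(A)\le\nu_H(A)$ for every subset $A\subset M$.
   Context: $H^*$ is a fixed cohomology functor with a cup product $\cup$. A category on $M$ is a map $\nu:2^M\to\mathbb{Z}\cup\{+\infty\}$ such that: (i) if $A\subset B$ then $\nu(A)\le\nu(B)$; (ii) $\nu(A\cup B)\le\nu(A)+\nu(B)$; (iii) for every $A\subset M$ there is an open set $U\subset M$ with $A\subset U$ and $\nu(A)=\nu(U)$; (iv) if $f:M\to M$ is continuous and homotopic to the identity $\mathrm{id}_M$, then $\nu(A)\le\nu(f(A))$ for every subset $A\subset M$. For $A\subset M$ with restriction map $j^*:H^*(M)\to H^*(A)$, $\mathrm{cuplength}(A)$ (the cup length of $A$ in $M$) is the minimum integer $N>0$ such that for any cohomology classes $\alpha_i\in H^{k_i}(M)$, $i=1,\dots,N$, of degrees $k_i\ge1$, the class $(\alpha_1\cup\cdots\cup\alpha_N)|_A=j^*(\alpha_1\cup\cdots\cup\alpha_N)$ is zero (with value $+\infty$ if there is no such $N$). The category $\nu_{CL}$ is the one defined from the cup length map by $\nu_{CL}(A)=\min\{\mathrm{cuplength}(U)\mid U\subset M\text{ open, containing }A\}$. A subset $A\subset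 M$ is cohomologically trivial in $M$ if the restriction map $j^*:H^k(M)\to H^k(A)$ is zero for $k>0$. $T_c=T_c(M)$ is the set of all cohomologically trivial open subsets of $M$. A T-collection on $M$ is a collection $T$ of open subsets of $M$ such that for every continuous map $f:M\to M$ homotopic to $\mathrm{id}_M$, $U\in T$ implies $f^{-1}(U)\in T$. For a T-collection $T$ on $M$, the associated category $\nu_T$ assigns to $A\subset M$ the minimum number $\nu_T(A)$ of open sets in $T$ required to cover $A$; if such a covering does not exist, $\nu_T(A)=+\infty$. Put $\nu_c=\nu_{T_c}$. For a category $\nu$ on $M$, $T_\nu=\{U\subset M\mid U\text{ is open and }\nu(U)\le1\}$, which is a T-collection. A subset $A\subset M$ is contractible in $M$ if the inclusion map $A\to M$ is homotopic to a constant. For $A\subset M$, $\nu_H(A)$ is the minimum number of open sets contractible in $M$ required to cover $A$; if such a covering does not exist, $\nu_H(A)=+\infty$. *)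

theory Defs
  imports "HOL-Analysis.Analysis" "HOL-Algebra.Coset" "HOL-Library.Extended_Nat"
begin

text \<open>
  A cohomology functor with a cup product is an arbitrary structure satisfying the
  Eilenberg--Steenrod axioms on pairs of spaces, together with relative cup products for open
  subsets.  All spaces are carried by subsets of one type \<^typ>\<open>'a\<close>: a functor on all
  topological spaces restricts to these, and only subspaces of a given space are used.  As in the
  library's homology theory, the (abelian) cohomology groups are written multiplicatively,
  so the zero class is \<open>\<one>\<close>, and \<open>H\<^sup>p(X)\<close> is the group of the pair \<open>(X, {})\<close>.

  \<open>induced p X A Y B f\<close> is \<open>f\<^sup>* : H\<^sup>p(Y, B) \<rightarrow> H\<^sup>p(X, A)\<close>;
  \<open>cobound p X A\<close> is \<open>\<delta> : H\<^sup>p(A) \<rightarrow> H\<^sup>p\<^sup>+\<^sup>1(X, A)\<close>;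
  \<open>cup X p A q B\<close> is
  \<open>\<union> : H\<^sup>p(X, A) \<times> H\<^sup>q(X, B) \<rightarrow> H\<^sup>p\<^sup>+\<^sup>q(X, A \<union> B)\<close>.
\<close>

record ('a, 'c) cohomology =
  Coh     :: "int \<Rightarrow> 'a topology \<Rightarrow> 'a set \<Rightarrow> 'c monoid"
  induced :: "int \<Rightarrow> 'a topology \<Rightarrow> 'a set \<Rightarrow> 'a topology \<Rightarrow> 'a set \<Rightarrow> ('a \<Rightarrow> 'a) \<Rightarrow> 'c \<Rightarrow> 'c"
  cobound :: "int \<Rightarrow> 'a topology \<Rightarrow> 'a set \<Rightarrow> 'c \<Rightarrow> 'c"
  cup     :: "'a topology \<Rightarrow> int \<Rightarrow> 'a set \<Rightarrow> int \<Rightarrow> 'a set \<Rightarrow> 'c \<Rightarrow> 'c \<Rightarrow> 'c"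
  unit    :: "'a topology \<Rightarrow> 'c"

definition pair_map :: "'a topology \<Rightarrow> 'a set \<Rightarrow> 'a topology \<Rightarrow> 'a set \<Rightarrow> ('a \<Rightarrow> 'a) \<Rightarrow> bool" where
  "pair_map X A Y B f \<longleftrightarrow>
     A \<subseteq> topspace X \<and> B \<subseteq> topspace Y \<and> continuous_map X Y f \<and> f ` A \<subseteq> B"

locale cohomology_theory =
  fixes H :: "('a, 'c) cohomology"
  assumes group: "A \<subseteq> topspace X \<Longrightarrow> comm_group (Coh H p X A)"
    and induced_hom:
      "pair_map X A Y B f \<Longrightarrow> induced H p X A Y B f \<in> hom (Coh H p Y B) (Coh H p X A)"
    and induced_id:
      "A \<subseteq> topspace X \<Longrightarrow> a \<in> carrier (Coh H p X A) \<Longrightarrow> induced H p X A X A id a = a"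
    and induced_comp:
      "pair_map X A Y B f \<Longrightarrow> pair_map Y B Z D g \<Longrightarrow> a \<in> carrier (Coh H p Z D) \<Longrightarrow>
       induced H p X A Z D (g \<circ> f) a = induced H p X A Y B f (induced H p Y B Z D g a)"
    and homotopy:
      "pair_map X A Y B f \<Longrightarrow> pair_map X A Y B g \<Longrightarrow>
       homotopic_with (\<lambda>h. h ` A \<subseteq> B) X Y f g \<Longrightarrow> a \<in> carrier (Coh H p Y B) \<Longrightarrow>
       induced H p X A Y B f a = induced H p X A Y B g a"
    and cobound_hom:
      "A \<subseteq> topspace X \<Longrightarrow>
       cobound H p X A \<in> hom (Coh H p (subtopology X A) {}) (Coh H (p + 1) X A)"
    and cobound_natural:
      "pair_map X A Y B f \<Longrightarrow> a \<in> carrier (Coh H p (subtopology Y B) {}) \<Longrightarrow>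
       cobound H p X A (induced H p (subtopology X A) {} (subtopology Y B) {} f a)
       = induced H (p + 1) X A Y B f (cobound H p Y B a)"
    and exact_pair:
      "A \<subseteq> topspace X \<Longrightarrow>
       induced H p X {} X A id ` carrier (Coh H p X A)
       = kernel (Coh H p X {}) (Coh H p (subtopology X A) {})
           (induced H p (subtopology X A) {} X {} id)"
    and exact_subspace:
      "A \<subseteq> topspace X \<Longrightarrow>
       induced H p (subtopology X A) {} X {} id ` carrier (Coh H p X {})
       = kernel (Coh H p (subtopology X A) {}) (Coh H (p + 1) X A) (cobound H p X A)"
    and exact_cobound:
      "A \<subseteq> topspace X \<Longrightarrow>
       cobound H p X A ` carrier (Coh H p (subtopology X A) {})
       = kernel (Coh H (p + 1) X A) (Coh H (p + 1) X {}) (induced H (p + 1) X {} X A id)"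
    and excision:
      "A \<subseteq> topspace X \<Longrightarrow> W \<subseteq> A \<Longrightarrow> X closure_of W \<subseteq> X interior_of A \<Longrightarrow>
       induced H p (subtopology X (topspace X - W)) (A - W) X A id
       \<in> iso (Coh H p X A) (Coh H p (subtopology X (topspace X - W)) (A - W))"
    and dimension:
      "topspace X = {x} \<Longrightarrow> p \<noteq> 0 \<Longrightarrow> carrier (Coh H p X {}) = {\<one>\<^bsub>Coh H p X {}\<^esub>}"
    and cup_closed:
      "openin X A \<Longrightarrow> openin X B \<Longrightarrow>
       a \<in> carrier (Coh H p X A) \<Longrightarrow> b \<in> carrier (Coh H q X B) \<Longrightarrow>
       cup H X p A q B a b \<in> carrier (Coh H (p + q) X (A \<union> B))"
    and cup_add_left:
      "openin X A \<Longrightarrow> openin X B \<Longrightarrow>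
       a \<in> carrier (Coh H p X A) \<Longrightarrow> a' \<in> carrier (Coh H p X A) \<Longrightarrow>
       b \<in> carrier (Coh H q X B) \<Longrightarrow>
       cup H X p A q B (a \<otimes>\<^bsub>Coh H p X A\<^esub> a') b
       = cup H X p A q B a b \<otimes>\<^bsub>Coh H (p + q) X (A \<union> B)\<^esub> cup H X p A q B a' b"
    and cup_add_right:
      "openin X A \<Longrightarrow> openin X B \<Longrightarrow>
       a \<in> carrier (Coh H p X A) \<Longrightarrow>
       b \<in> carrier (Coh H q X B) \<Longrightarrow> b' \<in> carrier (Coh H q X B) \<Longrightarrow>
       cup H X p A q B a (b \<otimes>\<^bsub>Coh H q X B\<^esub> b')
       = cup H X p A q B a b \<otimes>\<^bsub>Coh H (p + q) X (A \<union> B)\<^esub> cup H X p A q B a b'"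
    and cup_assoc:
      "openin X A \<Longrightarrow> openin X B \<Longrightarrow> openin X D \<Longrightarrow>
       a \<in> carrier (Coh H p X A) \<Longrightarrow> b \<in> carrier (Coh H q X B) \<Longrightarrow>
       d \<in> carrier (Coh H r X D) \<Longrightarrow>
       cup H X (p + q) (A \<union> B) r D (cup H X p A q B a b) d
       = cup H X p A (q + r) (B \<union> D) a (cup H X q B r D b d)"
    and unit_closed: "unit H X \<in> carrier (Coh H 0 X {})"
    and cup_unit_left:
      "openin X A \<Longrightarrow> a \<in> carrier (Coh H p X A) \<Longrightarrow> cup H X 0 {} p A (unit H X) a = a"
    and cup_unit_right:
      "openin X A \<Longrightarrow> a \<in> carrier (Coh H p X A) \<Longrightarrow> cup H X p A 0 {} a (unit H X) = a"
    and cup_natural: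
      "pair_map X A Y D f \<Longrightarrow> pair_map X B Y E f \<Longrightarrow>
       openin X A \<Longrightarrow> openin X B \<Longrightarrow> openin Y D \<Longrightarrow> openin Y E \<Longrightarrow>
       a \<in> carrier (Coh H p Y D) \<Longrightarrow> b \<in> carrier (Coh H q Y E) \<Longrightarrow>
       induced H (p + q) X (A \<union> B) Y (D \<union> E) f (cup H Y p D q E a b)
       = cup H X p A q B (induced H p X A Y D f a) (induced H q X B Y E f b)"
    and unit_natural:
      "continuous_map X Y f \<Longrightarrow> induced H 0 X {} Y {} f (unit H Y) = unit H X"

definition restriction ::
    "('a, 'c) cohomology \<Rightarrow> 'a topology \<Rightarrow> int \<Rightarrow> 'a set \<Rightarrow> 'c \<Rightarrow> 'c" where
  "restriction H M p A = induced H p (subtopology M A) {} M {} id"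

text \<open>\<open>cup_prod H M k \<alpha> N\<close> is \<open>\<alpha> 1 \<union> \<dots> \<union> \<alpha> N\<close>, where \<open>\<alpha> i\<close> has degree \<open>k i\<close>.\<close>

primrec cup_prod ::
    "('a, 'c) cohomology \<Rightarrow> 'a topology \<Rightarrow> (nat \<Rightarrow> int) \<Rightarrow> (nat \<Rightarrow> 'c) \<Rightarrow> nat \<Rightarrow> 'c" where
  "cup_prod H M k \<alpha> 0 = unit H M"
| "cup_prod H M k \<alpha> (Suc n) =
     cup H M (\<Sum>i=1..n. k i) {} (k (Suc n)) {} (cup_prod H M k \<alpha> n) (\<alpha> (Suc n))"

text \<open>
  Minima are infima in \<^typ>\<open>enat\<close>: attained on nonempty sets, and \<open>\<infinity>\<close> on the empty set.
\<close>

definition cuplength :: "('a, 'c) cohomology \<Rightarrow> 'a topology \<Rightarrow> 'a set \<Rightarrow> enat" where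
  "cuplength H M A = Inf {enat N | N. N > 0 \<and>
     (\<forall>k \<alpha>. (\<forall>i\<in>{1..N}. k i \<ge> 1 \<and> \<alpha> i \<in> carrier (Coh H (k i) M {})) \<longrightarrow>
       restriction H M (\<Sum>i=1..N. k i) A (cup_prod H M k \<alpha> N)
       = \<one>\<^bsub>Coh H (\<Sum>i=1..N. k i) (subtopology M A) {}\<^esub>)}"

definition nu_CL :: "('a, 'c) cohomology \<Rightarrow> 'a topology \<Rightarrow> 'a set \<Rightarrow> enat" where
  "nu_CL H M A = Inf {cuplength H M U | U. openin M U \<and> A \<subseteq> U}"

definition coh_trivial_in :: "('a, 'c) cohomology \<Rightarrow> 'a topology \<Rightarrow> 'a set \<Rightarrow> bool" where
  "coh_trivial_in H M A \<longleftrightarrow>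
     (\<forall>k>0. \<forall>a \<in> carrier (Coh H k M {}).
        restriction H M k A a = \<one>\<^bsub>Coh H k (subtopology M A) {}\<^esub>)"

definition T_c :: "('a, 'c) cohomology \<Rightarrow> 'a topology \<Rightarrow> 'a set set" where
  "T_c H M = {U. openin M U \<and> coh_trivial_in H M U}"

definition T_collection :: "'a topology \<Rightarrow> 'a set set \<Rightarrow> bool" where
  "T_collection M T \<longleftrightarrow>
     (\<forall>U\<in>T. openin M U) \<and>
     (\<forall>f. continuous_map M M f \<and> homotopic_with (\<lambda>_. True) M M f id \<longrightarrow>
        (\<forall>U\<in>T. {x \<in> topspace M. f x \<in> U} \<in> T))"

text \<open>
  Condition (ii) with \<open>A = B\<close> gives \<open>\<nu>(A) \<le> 2 \<nu>(A)\<close>, so a category with values in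
  \<open>\<int> \<union> {+\<infinity>}\<close> is nonnegative; hence \<^typ>\<open>enat\<close> is no restriction.
\<close>

definition category_on :: "'a topology \<Rightarrow> ('a set \<Rightarrow> enat) \<Rightarrow> bool" where
  "category_on M \<nu> \<longleftrightarrow>
     (\<forall>A B. A \<subseteq> B \<and> B \<subseteq> topspace M \<longrightarrow> \<nu> A \<le> \<nu> B) \<and>
     (\<forall>A B. A \<subseteq> topspace M \<and> B \<subseteq> topspace M \<longrightarrow> \<nu> (A \<union> B) \<le> \<nu> A + \<nu> B) \<and>
     (\<forall>A. A \<subseteq> topspace M \<longrightarrow> (\<exists>U. openin M U \<and> A \<subseteq> U \<and> \<nu> A = \<nu> U)) \<and>
     (\<forall>f. continuous_map M M f \<and> homotopic_with (\<lambda>_. True) M M f id \<longrightarrow>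
        (\<forall>A. A \<subseteq> topspace M \<longrightarrow> \<nu> A \<le> \<nu> (f ` A)))"

text \<open>
  A cover \<open>U\<^sub>1, \<dots>, U\<^sub>n\<close> has \<open>n \<ge> 1\<close> members, so the empty set does not get the value \<open>0\<close>.
  This matches \<open>cuplength \<ge> 1\<close>; counting the empty cover would make \<open>\<nu>\<^sub>C\<^sub>L \<le> \<nu>\<^sub>c\<close> fail at \<open>{}\<close>.
\<close>

definition nu_of :: "'a set set \<Rightarrow> 'a set \<Rightarrow> enat" where
  "nu_of T A = Inf {enat (card F) | F. finite F \<and> F \<noteq> {} \<and> F \<subseteq> T \<and> A \<subseteq> \<Union>F}"

definition nu_c :: "('a, 'c) cohomology \<Rightarrow> 'a topology \<Rightarrow> 'a set \<Rightarrow> enat" where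
  "nu_c H M = nu_of (T_c H M)"

definition T_of :: "'a topology \<Rightarrow> ('a set \<Rightarrow> enat) \<Rightarrow> 'a set set" where
  "T_of M \<nu> = {U. openin M U \<and> \<nu> U \<le> 1}"

definition contractible_in :: "'a topology \<Rightarrow> 'a set \<Rightarrow> bool" where
  "contractible_in M A \<longleftrightarrow>
     (\<exists>c. homotopic_with (\<lambda>_. True) (subtopology M A) M id (\<lambda>_. c))"

definition nu_H :: "'a topology \<Rightarrow> 'a set \<Rightarrow> enat" where
  "nu_H M = nu_of {U. openin M U \<and> contractible_in M U}"

end

theory Submission
  imports Defs
begin

text \<open>
  A class that vanishes on an open \<open>U\<^sub>i\<close> lifts to \<open>H\<^sup>*(M, U\<^sub>i)\<close>, so a product of \<open>N\<close> such
  classes lifts to \<open>H\<^sup>*(M, U\<^sub>1 \<union> \<dots> \<union> U\<^sub>N)\<close> and vanishes on the union; this gives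
  \<open>\<nu>\<^sub>C\<^sub>L \<le> \<nu>\<^sub>c\<close>.  The restriction of a class to a contractible set factors through the
  cohomology of a point, which gives \<open>\<nu>\<^sub>c \<le> \<nu>\<^sub>H\<close>.  Exactness for the pair \<open>({}, {})\<close> makes
  \<open>H\<^sup>*({})\<close> trivial, so the empty set already belongs to \<open>T\<^sub>c\<close>.
\<close>

section \<open>Identity maps as maps of pairs\<close>

lemma pair_map_id_subtopology:
  "A \<subseteq> B \<Longrightarrow> pair_map (subtopology X A) {} (subtopology X B) {} id"
  by (auto simp: pair_map_def continuous_map_in_subtopology continuous_map_from_subtopology)

lemma pair_map_id_subtopology_space: "pair_map (subtopology X A) {} X {} id"
  by (auto simp: pair_map_def continuous_map_from_subtopology)

lemma pair_map_id: "A \<subseteq> B \<Longrightarrow> B \<subseteq> topspace X \<Longrightarrow> pair_map X A X B id"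
  by (auto simp: pair_map_def)

section \<open>Covering numbers and the categories they define\<close>

lemma Inf_enat_attained:
  assumes "Inf {enat N | N. P N} \<noteq> \<infinity>"
  obtains N where "P N" "Inf {enat N | N. P N} = enat N"
proof -
  have "{enat N | N. P N} \<noteq> {}"
  proof
    assume empty: "{enat N | N. P N} = {}"
    show False
      using assms unfolding empty by (simp add: top_enat_def)
  qed
  then obtain x where "x \<in> {enat N | N. P N}"
    by blast
  then have "Inf {enat N | N. P N} \<in> {enat N | N. P N}"
    by (rule wellorder_InfI)
  then show thesis
    using that by blast
qed

lemma nu_of_le:
  assumes "finite F" "F \<noteq> {}" "F \<subseteq> T" "A \<subseteq> \<Union>F"
  shows "nu_of T A \<le> enat (card F)"
  unfolding nu_of_def using assms by (intro Inf_lower) blast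

lemma nu_of_finite_cover:
  assumes "nu_of T A \<noteq> \<infinity>"
  obtains F where "finite F" "F \<noteq> {}" "F \<subseteq> T" "A \<subseteq> \<Union>F" "nu_of T A = enat (card F)"
proof -
  \<comment> \<open>Covers are re-indexed by their cardinality, so that the set of values has the
    shape required by \<open>Inf_enat_attained\<close>.\<close>
  let ?P = "\<lambda>N. \<exists>F. N = card F \<and> finite F \<and> F \<noteq> {} \<and> F \<subseteq> T \<and> A \<subseteq> \<Union>F"
  have eq: "nu_of T A = Inf {enat N | N. ?P N}"
    unfolding nu_of_def by (intro arg_cong[of _ _ Inf]) blast
  obtain N where "?P N" "nu_of T A = enat N"
    using assms unfolding eq by (rule Inf_enat_attained)
  then show thesis
    using that by blast
qed

lemma nu_of_antimono: "S \<subseteq> T \<Longrightarrow> nu_of T A \<le> nu_of S A"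
  unfolding nu_of_def by (intro Inf_superset_mono) blast

lemma nu_of_mono: "A \<subseteq> B \<Longrightarrow> nu_of T A \<le> nu_of T B"
  unfolding nu_of_def by (intro Inf_superset_mono) blast

text \<open>Minimal covers of the two sets unite to a cover of the union; members shared by both
  only lower the count.\<close>

lemma nu_of_Un: "nu_of T (A \<union> B) \<le> nu_of T A + nu_of T B"
proof (cases "nu_of T A = \<infinity> \<or> nu_of T B = \<infinity>")
  case False
  then obtain F G
    where F: "finite F" "F \<noteq> {}" "F \<subseteq> T" "A \<subseteq> \<Union>F" "nu_of T A = enat (card F)"
      and G: "finite G" "G \<noteq> {}" "G \<subseteq> T" "B \<subseteq> \<Union>G" "nu_of T B = enat (card G)"
    by (metis nu_of_finite_cover)
  have "nu_of T (A \<union> B) \<le> enat (card (F \<union> G))"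
    using F G by (intro nu_of_le) auto
  also have "\<dots> \<le> nu_of T A + nu_of T B"
    using F G by (simp add: card_Un_le)
  finally show ?thesis .
qed auto

lemma category_on_nu_of:
  assumes T: "T_collection M T"
  shows "category_on M (nu_of T)"
  unfolding category_on_def
proof (intro conjI allI impI)
  fix A assume A: "A \<subseteq> topspace M"
  show "\<exists>U. openin M U \<and> A \<subseteq> U \<and> nu_of T A = nu_of T U"
  proof (cases "nu_of T A = \<infinity>")
    case True
    \<comment> \<open>An infinite value passes to every larger set, so the whole space is a suitable
      neighbourhood.\<close>
    then have "nu_of T A = nu_of T (topspace M)"
      using nu_of_mono[OF A, of T] by simp
    with A show ?thesis by blast
  next
    case False
    then obtain F where F: "finite F" "F \<noteq> {}" "F \<subseteq> T" "A \<subseteq> \<Union>F" "nu_of T A = enat (card F)"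
      by (rule nu_of_finite_cover)
    have "openin M (\<Union>F)"
      using F(3) T unfolding T_collection_def by blast
    \<comment> \<open>\<open>F\<close> covers its own union, so the value there is at most
      \<open>card F\<close>; monotonicity gives the other inequality.\<close>
    moreover have "nu_of T A = nu_of T (\<Union>F)"
      using F nu_of_le[of F T "\<Union>F"] nu_of_mono[of A "\<Union>F" T] by auto
    ultimately show ?thesis
      using F(4) by blast
  qed
next
  fix f A
  assume f: "continuous_map M M f \<and> homotopic_with (\<lambda>_. True) M M f id"
    and A: "A \<subseteq> topspace M"
  show "nu_of T A \<le> nu_of T (f ` A)"
  proof (cases "nu_of T (f ` A) = \<infinity>")
    case False
    then obtain F where F: "finite F" "F \<noteq> {}" "F \<subseteq> T" "f ` A \<subseteq> \<Union>F"
      "nu_of T (f ` A) = enat (card F)"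
      by (rule nu_of_finite_cover)
    let ?G = "(\<lambda>U. {x \<in> topspace M. f x \<in> U}) ` F"
    have "?G \<subseteq> T"
      using T f F(3) unfolding T_collection_def by blast
    moreover have "A \<subseteq> \<Union>?G"
      using F(4) A by blast
    ultimately have "nu_of T A \<le> enat (card ?G)"
      using F(1,2) by (intro nu_of_le) auto
    \<comment> \<open>Distinct members of \<open>F\<close> may have the same preimage, so only an
      inequality holds.\<close>
    also have "\<dots> \<le> enat (card F)"
      using F(1) by (simp add: card_image_le)
    finally show ?thesis
      using F(5) by simp
  qed simp
qed (auto intro: nu_of_mono nu_of_Un)

lemma sum_atLeastAtMost_1_Suc: "(\<Sum>i=1..Suc n. k i) = (\<Sum>i=1..n. k i) + (k (Suc n) :: int)"
  by simp

section \<open>Functoriality of restriction, and the empty space\<close>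

context cohomology_theory
begin

lemma one_closed: "A \<subseteq> topspace X \<Longrightarrow> \<one>\<^bsub>Coh H p X A\<^esub> \<in> carrier (Coh H p X A)"
  by (metis group comm_group.axioms(2) group.is_monoid monoid.one_closed)

lemma induced_closed:
  "pair_map X A Y B f \<Longrightarrow> a \<in> carrier (Coh H p Y B) \<Longrightarrow>
   induced H p X A Y B f a \<in> carrier (Coh H p X A)"
  using induced_hom by (rule hom_in_carrier)

lemma induced_one:
  assumes "pair_map X A Y B f"
  shows "induced H p X A Y B f \<one>\<^bsub>Coh H p Y B\<^esub> = \<one>\<^bsub>Coh H p X A\<^esub>"
proof (rule hom_one[OF induced_hom[OF assms]])
  show "Group.group (Coh H p Y B)" "Group.group (Coh H p X A)"
    using assms group comm_group.axioms(2) unfolding pair_map_def by blast+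
qed

lemma restriction_closed:
  "a \<in> carrier (Coh H p X {}) \<Longrightarrow>
   restriction H X p A a \<in> carrier (Coh H p (subtopology X A) {})"
  unfolding restriction_def by (rule induced_closed[OF pair_map_id_subtopology_space])

lemma restriction_subset:
  assumes "A \<subseteq> B" "a \<in> carrier (Coh H p X {})"
  shows "restriction H X p A a
         = induced H p (subtopology X A) {} (subtopology X B) {} id (restriction H X p B a)"
  unfolding restriction_def
  using induced_comp[OF pair_map_id_subtopology[OF assms(1)] pair_map_id_subtopology_space assms(2)]
  by simp

lemma restriction_one_subset:
  assumes "A \<subseteq> B" "a \<in> carrier (Coh H p X {})"
    and "restriction H X p B a = \<one>\<^bsub>Coh H p (subtopology X B) {}\<^esub>"
  shows "restriction H X p A a = \<one>\<^bsub>Coh H p (subtopology X A) {}\<^esub>"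
  using assms restriction_subset induced_one[OF pair_map_id_subtopology[OF assms(1)]] by metis

text \<open>A space without points equals its empty subspace, so both maps in the exact sequence of
  the pair are the identity: the image is the whole group, the kernel is trivial, and exactness
  equates them.\<close>

lemma carrier_empty_space:
  assumes "topspace X = {}"
  shows "carrier (Coh H p X {}) = {\<one>\<^bsub>Coh H p X {}\<^esub>}"
proof -
  have X: "subtopology X {} = X"
    using assms by (metis subtopology_topspace)
  have "induced H p X {} X {} id ` carrier (Coh H p X {})
        = kernel (Coh H p X {}) (Coh H p X {}) (induced H p X {} X {} id)"
    using exact_pair[of "{}" X p] X by simp
  then have "carrier (Coh H p X {}) \<subseteq> {\<one>\<^bsub>Coh H p X {}\<^esub>}"
    using induced_id[of "{}" X _ p] unfolding kernel_def by force
  then show ?thesis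
    using one_closed[of "{}" X p] by auto
qed

text \<open>Restrictions to the empty set land in a trivial group. This is why adjoining
  \<open>{}\<close> to \<open>T_c\<close> changes nothing.\<close>

lemma empty_in_T_c: "{} \<in> T_c H X"
proof -
  have "restriction H X p {} a = \<one>\<^bsub>Coh H p (subtopology X {}) {}\<^esub>"
    if "a \<in> carrier (Coh H p X {})" for p a
    using restriction_closed[OF that, of "{}"] carrier_empty_space[of "subtopology X {}" p] by simp
  then show ?thesis
    unfolding T_c_def coh_trivial_in_def by simp
qed

section \<open>Deformation invariance of \<open>T_c\<close>, and contractible sets\<close>

lemma induced_homotopic:
  assumes "homotopic_with (\<lambda>_. True) X Y f g" "a \<in> carrier (Coh H p Y {})"
  shows "induced H p X {} Y {} f a = induced H p X {} Y {} g a"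
proof (rule homotopy)
  show "pair_map X {} Y {} f" "pair_map X {} Y {} g"
    using homotopic_with_imp_continuous_maps[OF assms(1)] by (simp_all add: pair_map_def)
qed (use assms in simp_all)

text \<open>Since \<open>f\<close> induces the identity on the cohomology of \<open>X\<close>,
  restriction to the preimage of \<open>U\<close> may be preceded by the map induced by
  \<open>f\<close>, and the composite factors through restriction to \<open>U\<close>.\<close>

lemma T_collection_T_c: "T_collection X (T_c H X)"
  unfolding T_collection_def
proof (intro conjI ballI allI impI)
  fix f U
  assume f: "continuous_map X X f \<and> homotopic_with (\<lambda>_. True) X X f id" and U: "U \<in> T_c H X"
  let ?V = "{x \<in> topspace X. f x \<in> U}"
  have f_pair: "pair_map X {} X {} f"
    using f by (simp add: pair_map_def)
  have fU: "pair_map (subtopology X ?V) {} (subtopology X U) {} f"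
    using f by (auto simp: pair_map_def continuous_map_in_subtopology
        intro: continuous_map_from_subtopology)
  have "restriction H X p ?V a = \<one>\<^bsub>Coh H p (subtopology X ?V) {}\<^esub>"
    if p: "p > 0" and a: "a \<in> carrier (Coh H p X {})" for p a
  proof -
    have "restriction H X p ?V a
          = induced H p (subtopology X ?V) {} X {} id (induced H p X {} X {} f a)"
      using induced_homotopic[OF _ a, of X f id] f induced_id[OF _ a] unfolding restriction_def by simp
    also have "\<dots> = induced H p (subtopology X ?V) {} X {} (f \<circ> id) a"
      using induced_comp[OF pair_map_id_subtopology_space f_pair a] by simp
    also have "\<dots> = induced H p (subtopology X ?V) {} (subtopology X U) {} f (restriction H X p U a)"
      using induced_comp[OF fU pair_map_id_subtopology_space a] unfolding restriction_def by simp
    also have "\<dots> = \<one>\<^bsub>Coh H p (subtopology X ?V) {}\<^esub>"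
      using U p a induced_one[OF fU] unfolding T_c_def coh_trivial_in_def by simp
    finally show ?thesis .
  qed
  moreover have "openin X ?V"
    using f U unfolding T_c_def by (auto intro: openin_continuous_map_preimage)
  ultimately show "?V \<in> T_c H X"
    unfolding T_c_def coh_trivial_in_def by simp
qed (simp add: T_c_def)

lemma contractible_in_imp_coh_trivial_in:
  assumes "contractible_in X U" "U \<subseteq> topspace X"
  shows "coh_trivial_in H X U"
proof (cases "U = {}")
  case True
  then show ?thesis
    using empty_in_T_c unfolding T_c_def by simp
next
  case False
  obtain c where c: "homotopic_with (\<lambda>_. True) (subtopology X U) X id (\<lambda>_. c)"
    using assms(1) unfolding contractible_in_def by blast
  \<comment> \<open>Continuity places \<open>c\<close> in \<open>X\<close> only when
    \<open>U\<close> has a point, hence the separate treatment of the empty set.\<close>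
  have "(\<lambda>_. c) \<in> topspace (subtopology X U) \<rightarrow> topspace X"
    using homotopic_with_imp_continuous_maps[OF c] by (simp only: continuous_map_def)
  then have "c \<in> topspace X"
    using False assms(2) by auto
  then have pt: "topspace (subtopology X {c}) = {c}"
    by simp
  have const: "pair_map (subtopology X U) {} (subtopology X {c}) {} (\<lambda>_. c)"
    using \<open>c \<in> topspace X\<close> by (simp add: pair_map_def)
  show ?thesis
    unfolding coh_trivial_in_def
  proof (intro allI ballI impI)
    fix p :: int and a
    assume p: "0 < p" and a: "a \<in> carrier (Coh H p X {})"
    \<comment> \<open>The inclusion is replaced by the homotopic constant map, written as a
      composite through the one-point subspace \<open>{c}\<close>.\<close>
    have "restriction H X p U a = induced H p (subtopology X U) {} X {} (id \<circ> (\<lambda>_. c)) a"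
      unfolding restriction_def using induced_homotopic[OF c a] by (simp add: comp_def)
    also have "\<dots> = induced H p (subtopology X U) {} (subtopology X {c}) {} (\<lambda>_. c)
                      (restriction H X p {c} a)"
      using induced_comp[OF const pair_map_id_subtopology_space a] unfolding restriction_def by simp
    also have "restriction H X p {c} a = \<one>\<^bsub>Coh H p (subtopology X {c}) {}\<^esub>"
      using restriction_closed[OF a, of "{c}"] dimension[OF pt, of p] p by simp
    finally show "restriction H X p U a = \<one>\<^bsub>Coh H p (subtopology X U) {}\<^esub>"
      using induced_one[OF const] by simp
  qed
qed

lemma nu_c_le_nu_H: "nu_c H X A \<le> nu_H X A"
  unfolding nu_c_def nu_H_def T_c_def
  by (rule nu_of_antimono) (auto simp: openin_subset contractible_in_imp_coh_trivial_in)

section \<open>Cup products and cup length\<close>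

lemma cup_prod_closed:
  assumes "\<forall>i\<in>{1..n}. \<alpha> i \<in> carrier (Coh H (k i) X {})"
  shows "cup_prod H X k \<alpha> n \<in> carrier (Coh H (\<Sum>i=1..n. k i) X {})"
  using assms
proof (induction n)
  case (Suc n)
  then show ?case
    using cup_closed[of X "{}" "{}" "cup_prod H X k \<alpha> n" "\<Sum>i=1..n. k i" "\<alpha> (Suc n)" "k (Suc n)"]
    by (simp add: sum_atLeastAtMost_1_Suc)
qed (simp add: unit_closed)

text \<open>Restriction to \<open>A\<close> factors through restriction to \<open>B\<close>, so
  every \<open>N\<close> admissible for \<open>B\<close> is admissible for \<open>A\<close>.\<close>

lemma cuplength_mono:
  assumes "A \<subseteq> B"
  shows "cuplength H X A \<le> cuplength H X B"
  unfolding cuplength_def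
proof (rule Inf_superset_mono, rule subsetI, clarify, intro exI conjI, rule refl, assumption, intro allI impI)
  fix N k \<alpha>
  assume B: "\<forall>k \<alpha>. (\<forall>i\<in>{1..N}. 1 \<le> k i \<and> \<alpha> i \<in> carrier (Coh H (k i) X {})) \<longrightarrow>
       restriction H X (\<Sum>i=1..N. k i) B (cup_prod H X k \<alpha> N)
       = \<one>\<^bsub>Coh H (\<Sum>i=1..N. k i) (subtopology X B) {}\<^esub>"
    and \<alpha>: "\<forall>i\<in>{1..N}. 1 \<le> k i \<and> \<alpha> i \<in> carrier (Coh H (k i) X {})"
  show "restriction H X (\<Sum>i=1..N. k i) A (cup_prod H X k \<alpha> N)
       = \<one>\<^bsub>Coh H (\<Sum>i=1..N. k i) (subtopology X A) {}\<^esub>"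
    by (rule restriction_one_subset[OF assms cup_prod_closed]) (use B \<alpha> in auto)
qed

text \<open>An open set is its own smallest open neighbourhood, so monotonicity places the minimum
  there.\<close>

lemma nu_CL_open:
  assumes "openin X U"
  shows "nu_CL H X U = cuplength H X U"
  unfolding nu_CL_def
proof (rule antisym)
  show "Inf {cuplength H X V |V. openin X V \<and> U \<subseteq> V} \<le> cuplength H X U"
    using assms by (intro Inf_lower) blast
  show "cuplength H X U \<le> Inf {cuplength H X V |V. openin X V \<and> U \<subseteq> V}"
    using cuplength_mono by (intro Inf_greatest) blast
qed

text \<open>A product with one factor is the unit times that factor, so the case
  \<open>N = 1\<close> of the cup length condition is exactly cohomological triviality.\<close>

lemma cuplength_le_1_iff: "cuplength H X A \<le> 1 \<longleftrightarrow> coh_trivial_in H X A"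
proof
  let ?P = "\<lambda>N. N > 0 \<and>
     (\<forall>k \<alpha>. (\<forall>i\<in>{1..N}. k i \<ge> 1 \<and> \<alpha> i \<in> carrier (Coh H (k i) X {})) \<longrightarrow>
       restriction H X (\<Sum>i=1..N. k i) A (cup_prod H X k \<alpha> N)
       = \<one>\<^bsub>Coh H (\<Sum>i=1..N. k i) (subtopology X A) {}\<^esub>)"
  assume le: "cuplength H X A \<le> 1"
  then have "Inf {enat N | N. ?P N} \<noteq> \<infinity>"
    unfolding cuplength_def by (metis enat_ord_code(4) infinity_ne_i1 top.extremum_unique top_enat_def)
  then obtain N where N: "?P N" "cuplength H X A = enat N"
    unfolding cuplength_def by (rule Inf_enat_attained)
  \<comment> \<open>Cup length counts from 1, so the bound leaves a single value.\<close>
  then have "N = 1"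
    using le N by (simp add: one_enat_def)
  show "coh_trivial_in H X A"
    unfolding coh_trivial_in_def
  proof (intro allI ballI impI)
    fix p :: int and a
    assume "0 < p" "a \<in> carrier (Coh H p X {})"
    then show "restriction H X p A a = \<one>\<^bsub>Coh H p (subtopology X A) {}\<^esub>"
      using N(1)[unfolded \<open>N = 1\<close>, THEN conjunct2, rule_format, of "\<lambda>_. p" "\<lambda>_. a"]
      by (simp add: cup_unit_left)
  qed
next
  assume "coh_trivial_in H X A"
  then show "cuplength H X A \<le> 1"
    unfolding cuplength_def one_enat_def coh_trivial_in_def
    by (intro Inf_lower) (auto simp: cup_unit_left)
qed

lemma T_of_nu_CL: "T_of X (nu_CL H X) = T_c H X"
  unfolding T_of_def T_c_def using nu_CL_open cuplength_le_1_iff by auto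

section \<open>Relative lifts and the cup length bound from covers\<close>

lemma coh_trivial_in_lift:
  assumes "coh_trivial_in H X U" "U \<subseteq> topspace X" "p > 0" "a \<in> carrier (Coh H p X {})"
  obtains b where "b \<in> carrier (Coh H p X U)" "induced H p X {} X U id b = a"
proof -
  \<comment> \<open>Vanishing on \<open>U\<close> puts \<open>a\<close> in the kernel of
    restriction, which exactness identifies with the image of the cohomology of the pair
    \<open>(X, U)\<close>.\<close>
  have "a \<in> kernel (Coh H p X {}) (Coh H p (subtopology X U) {})
              (induced H p (subtopology X U) {} X {} id)"
    using assms unfolding kernel_def coh_trivial_in_def restriction_def by simp
  then have "a \<in> induced H p X {} X U id ` carrier (Coh H p X U)"
    unfolding exact_pair[OF assms(2), of p] .
  then show thesis
    using that by (elim imageE) simp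
qed

text \<open>By induction, a lift of the first \<open>n\<close> factors is multiplied by a lift of
  the last one; the relative cup product lives over the union of the two open sets.\<close>

lemma cup_prod_lift:
  assumes "\<forall>i\<in>{1..n}. 1 \<le> k i \<and> \<alpha> i \<in> carrier (Coh H (k i) X {})"
    and "\<forall>i\<in>{1..n}. U i \<in> T_c H X"
  shows "\<exists>b \<in> carrier (Coh H (\<Sum>i=1..n. k i) X (\<Union>i\<in>{1..n}. U i)).
           induced H (\<Sum>i=1..n. k i) X {} X (\<Union>i\<in>{1..n}. U i) id b = cup_prod H X k \<alpha> n"
  using assms
proof (induction n)
  case 0
  \<comment> \<open>The union over no indices is empty, so the unit is its own lift.\<close>
  have "induced H 0 X {} X {} id (unit H X) = unit H X"
    using unit_closed by (rule induced_id[OF empty_subsetI])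
  then have "\<exists>b \<in> carrier (Coh H 0 X {}). induced H 0 X {} X {} id b = unit H X"
    using unit_closed by (rule bexI)
  then show ?case
    by (simp add: id_def)
next
  case (Suc n)
  let ?s = "\<Sum>i=1..n. k i" and ?V = "\<Union>i\<in>{1..n}. U i"
  have "\<exists>b \<in> carrier (Coh H ?s X ?V). induced H ?s X {} X ?V id b = cup_prod H X k \<alpha> n"
    by (rule Suc.IH) (use Suc.prems in simp_all)
  then obtain b where b: "b \<in> carrier (Coh H ?s X ?V)"
    "induced H ?s X {} X ?V id b = cup_prod H X k \<alpha> n"
    by blast
  have U: "openin X (U (Suc n))" "coh_trivial_in H X (U (Suc n))"
    using Suc.prems(2) unfolding T_c_def by auto
  have V: "openin X ?V"
    using Suc.prems(2) unfolding T_c_def by auto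
  obtain d where d: "d \<in> carrier (Coh H (k (Suc n)) X (U (Suc n)))"
    "induced H (k (Suc n)) X {} X (U (Suc n)) id d = \<alpha> (Suc n)"
  proof (rule coh_trivial_in_lift[OF U(2) openin_subset[OF U(1)]])
    show "k (Suc n) > 0" "\<alpha> (Suc n) \<in> carrier (Coh H (k (Suc n)) X {})"
      using Suc.prems(1)[rule_format, of "Suc n"] by simp_all
  qed
  have un: "(\<Union>i\<in>{1..Suc n}. U i) = ?V \<union> U (Suc n)"
    by (auto simp: atLeastAtMostSuc_conv)
  \<comment> \<open>Naturality of the cup product for the identity, from empty relative sets to
    \<open>?V\<close> and \<open>U (Suc n)\<close>, turns the product of the lifts into the product
    of the absolute classes.\<close>
  have "induced H (?s + k (Suc n)) X {} X (?V \<union> U (Suc n)) id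
          (cup H X ?s ?V (k (Suc n)) (U (Suc n)) b d) = cup_prod H X k \<alpha> (Suc n)"
    using cup_natural[of X "{}" X ?V id "{}" "U (Suc n)", OF _ _ _ _ V U(1) b(1) d(1)]
      pair_map_id[of "{}", OF _ openin_subset[OF V]]
      pair_map_id[of "{}", OF _ openin_subset[OF U(1)]]
    by (simp add: b(2)[simplified] d(2))
  moreover have "cup H X ?s ?V (k (Suc n)) (U (Suc n)) b d
      \<in> carrier (Coh H (?s + k (Suc n)) X (?V \<union> U (Suc n)))"
    using V U(1) b(1) d(1) by (rule cup_closed)
  ultimately show ?case
    unfolding un sum_atLeastAtMost_1_Suc by (rule bexI)
qed

text \<open>A product of \<open>card F\<close> classes, one for each member of \<open>F\<close>,
  lifts to the cohomology of the pair \<open>(X, \<Union>F)\<close>; by exactness, classes coming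
  from there restrict to zero on \<open>\<Union>F\<close>.\<close>

lemma cuplength_Union_le:
  assumes "finite F" "F \<noteq> {}" "F \<subseteq> T_c H X"
  shows "cuplength H X (\<Union>F) \<le> enat (card F)"
  unfolding cuplength_def
proof (rule Inf_lower, rule CollectI, intro exI conjI allI impI, rule refl)
  \<comment> \<open>Nonemptiness of the cover matches the condition \<open>N > 0\<close> in
    \<open>cuplength\<close>.\<close>
  show "0 < card F"
    using assms by (simp add: card_gt_0_iff)
  fix k \<alpha>
  assume \<alpha>: "\<forall>i\<in>{1..card F}. 1 \<le> k i \<and> \<alpha> i \<in> carrier (Coh H (k i) X {})"
  let ?s = "\<Sum>i=1..card F. k i"
  \<comment> \<open>An enumeration of \<open>F\<close> from 1 assigns the \<open>i\<close>-th open
    set to the \<open>i\<close>-th factor.\<close>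
  obtain U where "bij_betw U {1..card F} F"
    using ex_bij_betw_nat_finite_1[OF assms(1)] by blast
  then have U: "U ` {1..card F} = F"
    by (rule bij_betw_imp_surj_on)
  then have "\<forall>i\<in>{1..card F}. U i \<in> T_c H X"
    using assms(3) by blast
  from cup_prod_lift[OF \<alpha> this]
  obtain b where b: "b \<in> carrier (Coh H ?s X (\<Union>F))"
    "induced H ?s X {} X (\<Union>F) id b = cup_prod H X k \<alpha> (card F)"
    unfolding U by blast
  have "\<Union>F \<subseteq> topspace X"
    using assms(3) openin_subset unfolding T_c_def by blast
  from exact_pair[OF this, of ?s]
  have "induced H ?s X {} X (\<Union>F) id b \<in> kernel (Coh H ?s X {})
          (Coh H ?s (subtopology X (\<Union>F)) {}) (induced H ?s (subtopology X (\<Union>F)) {} X {} id)"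
    using b(1) by blast
  then show "restriction H X ?s (\<Union>F) (cup_prod H X k \<alpha> (card F))
      = \<one>\<^bsub>Coh H ?s (subtopology X (\<Union>F)) {}\<^esub>"
    unfolding b(2) restriction_def kernel_def by blast
qed

text \<open>The union of a minimal cover by members of \<open>T_c\<close> is an open neighbourhood
  of \<open>A\<close> whose cup length is at most the size of the cover.\<close>

lemma nu_CL_le_nu_c: "nu_CL H X A \<le> nu_c H X A"
proof (cases "nu_c H X A = \<infinity>")
  case False
  then obtain F where F: "finite F" "F \<noteq> {}" "F \<subseteq> T_c H X" "A \<subseteq> \<Union>F" "nu_c H X A = enat (card F)"
    unfolding nu_c_def by (rule nu_of_finite_cover)
  have "openin X (\<Union>F)"
    using F(3) unfolding T_c_def by blast
  then have "nu_CL H X A \<le> cuplength H X (\<Union>F)"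
    unfolding nu_CL_def using F(4) by (intro Inf_lower) blast
  also have "\<dots> \<le> nu_c H X A"
    using cuplength_Union_le[OF F(1-3)] F(5) by simp
  finally show ?thesis .
qed simp

end

theorem mainTheorem3:
  fixes H :: "('a, 'c) cohomology" and M :: "'a topology"
  assumes "cohomology_theory H"
  shows "T_collection M (T_c H M) \<and>
         category_on M (nu_c H M) \<and>
         T_of M (nu_CL H M) = T_c H M \<union> {{}} \<and>
         (\<forall>A. A \<subseteq> topspace M \<longrightarrow> nu_c H M A = nu_of (T_of M (nu_CL H M)) A) \<and>
         (\<forall>A. A \<subseteq> topspace M \<longrightarrow> nu_CL H M A \<le> nu_of (T_of M (nu_CL H M)) A) \<and>
         (\<forall>A. A \<subseteq> topspace M \<longrightarrow> nu_CL H M A \<le> nu_c H M A \<and> nu_c H M A \<le> nu_H M A)"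
proof -
  interpret cohomology_theory H
    by (rule assms)
  have "category_on M (nu_c H M)"
    unfolding nu_c_def by (rule category_on_nu_of[OF T_collection_T_c])
  \<comment> \<open>With \<open>{}\<close> already in \<open>T_c\<close>, both sides of the identity
    for \<open>T_of\<close> reduce to \<open>T_c\<close>, so the covering numbers coincide.\<close>
  moreover have "T_c H M \<union> {{}} = T_c H M"
    using empty_in_T_c by blast
  ultimately show ?thesis
    using T_collection_T_c[of M] nu_CL_le_nu_c[of M] nu_c_le_nu_H[of M]
    unfolding T_of_nu_CL nu_c_def by simp
qed

end
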